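(* Let $n$ be a positive integer and let $S_n$ be the symmetric group on $n$ symbols. The power graph $\mathcal{P}(S_n)$ is a chordal graph if and only if $n\le 5$.
   Context: The power graph $\mathcal{P}(G)$ of a group $G$ is the undirected simple graph with vertex set $G$ in which distinct $a,b$ are adjacent iff $a=b^m$ or $b=a^n$ for some positive integers $m,n$. A graph is chordal if it has no induced cycle of length $4$ or more. *)

theory Defs
  imports "HOL-Algebra.Sym_Groups" "Graph_Theory.Graph_Theory"
begin

text \<open>
  Undirected graphs are represented, as usual in Graph_Theory, by symmetric digraphs: an edge
  between \<open>a\<close> and \<open>b\<close> is the pair of arcs \<open>(a, b)\<close>, \<open>(b, a)\<close>.
\<close>

definition power_graph :: "('a, 'b) monoid_scheme \<Rightarrow> 'a pair_pre_digraph" where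
  "power_graph G = \<lparr> pverts = carrier G,
     parcs = {(a, b). a \<in> carrier G \<and> b \<in> carrier G \<and> a \<noteq> b \<and>
       ((\<exists>m::nat. 0 < m \<and> a = b [^]\<^bsub>G\<^esub> m) \<or> (\<exists>n::nat. 0 < n \<and> b = a [^]\<^bsub>G\<^esub> n))} \<rparr>"

lemma power_graph_bidirected: "pair_bidirected_digraph (power_graph G)"
  by unfold_locales (auto simp: power_graph_def symmetric_def intro!: symI)

lemma power_graph_pair_graph:
  assumes "finite (carrier G)"
  shows "pair_graph (power_graph G)"
proof -
  interpret pair_bidirected_digraph "power_graph G"
    by (rule power_graph_bidirected)
  have "parcs (power_graph G) \<subseteq> carrier G \<times> carrier G"
    by (auto simp: power_graph_def)
  then have "finite (parcs (power_graph G))"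
    using assms by (meson finite_SigmaI finite_subset)
  then show ?thesis
    using assms by unfold_locales (auto simp: power_graph_def)
qed

text \<open>
  The vertices of the cycle \<open>p\<close> are the tails of its arcs. The cycle is induced if the subgraph
  induced by these vertices has no edges besides those traversed by \<open>p\<close>; as \<open>p\<close> traverses each
  edge in one direction only, its arcs have to be closed under symmetry for this comparison.
\<close>

definition induced_cycle :: "'a pair_pre_digraph \<Rightarrow> ('a \<times> 'a) awalk \<Rightarrow> bool" where
  "induced_cycle G p \<longleftrightarrow> pre_digraph.cycle (with_proj G) p \<and>
     arcs (with_proj G \<restriction> (fst ` set p)) = (set p)\<^sup>s"

definition chordal :: "'a pair_pre_digraph \<Rightarrow> bool" where
  "chordal G \<longleftrightarrow> \<not> (\<exists>p. induced_cycle G p \<and> 4 \<le> length p)"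

end

theory Submission
  imports Defs "HOL-Algebra.Multiplicative_Group" "HOL-Computational_Algebra.Primes"
begin

text \<open>
  The power graph of a group is the comparability graph of the preorder \<open>power_of\<close>, where \<open>a\<close> is below \<open>b\<close>
  if \<open>a\<close> is a positive power of \<open>b\<close>. By transitivity, the vertices of an induced cycle of length at least four
  alternate between local maxima and local minima, and the two minima next to a
  maximum \<open>v\<close> are incomparable powers of \<open>v\<close>. Hence the graph is chordal whenever, of any two incomparable
  powers of an element \<open>v\<close>, one has the property that all elements above it are comparable to
  \<open>v\<close> (\<open>chordal_power_graphI\<close>): the maxima on either side of that minimum
  are then adjacent, so the cycle has a chord.

  Let \<open>n \<le> 5\<close>. A permutation of order \<open>N\<close> has incomparable powers only if \<open>N\<close> is not a prime power,
  and centralizer computations leave only \<open>N = 6\<close> (\<open>ord_sym_group_le_5_dvd\<close>). Then one of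
  the incomparable powers is a 3-cycle. The centralizer of a 3-cycle \<open>c\<close> is generated by \<open>c\<close> and
  the permutations of the at most two remaining points (\<open>centralizer_three_cycle\<close>), so the elements above \<open>c\<close> form
  a chain (\<open>sym_group_chain_above_three_cycle\<close>), and the criterion applies.

  Let \<open>n \<ge> 6\<close>. For \<open>i\<close> and \<open>j\<close> in \<open>{2, 3, 4}\<close>, the 3-cycle \<open>(i 5 6)\<close> and the transposition \<open>(1 j)\<close> commute
  if and only if \<open>i \<noteq> j\<close>, and then their product has order 6 and lies above both. The three 3-cycles, the three
  transpositions and the six products form an induced cycle of length 12
  (\<open>not_chordal_power_graph_sym_group\<close>).
\<close>

section \<open>Induced cycles\<close>

text \<open>
  A cycle on the vertex list \<open>xs\<close> is the arc list \<open>zip xs (rotate1 xs)\<close>: each vertex is paired with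
  its successor, and the last one with the first. Splitting off the final target \<open>z\<close> makes the
  consistency of this walk provable by induction.
\<close>

lemma cas_zip_successors:
  "pre_digraph.cas (with_proj G) x (zip (x # ys) (ys @ [z])) z"
proof (induction ys arbitrary: x)
  case Nil
  then show ?case by (simp add: pre_digraph.cas.simps)
next
  case (Cons y ys)
  then show ?case by (simp add: pre_digraph.cas.simps)
qed

lemma induced_cycle_zip_rotate1:
  assumes "xs \<noteq> []" "distinct xs" "set xs \<subseteq> pverts G"
    and arcs: "\<And>a b. a \<in> set xs \<Longrightarrow> b \<in> set xs \<Longrightarrow>
      (a, b) \<in> parcs G \<longleftrightarrow> (a, b) \<in> (set (zip xs (rotate1 xs)))\<^sup>s"
  shows "induced_cycle G (zip xs (rotate1 xs))"
proof -
  let ?p = "zip xs (rotate1 xs)"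
  obtain x ys where xs: "xs = x # ys" using assms(1) by (cases xs) auto
  have fst_p: "map fst ?p = xs" and snd_p: "map snd ?p = rotate1 xs" by simp_all
  have ends: "e \<in> set ?p \<Longrightarrow> fst e \<in> set xs \<and> snd e \<in> set xs" for e
    using fst_p snd_p by (metis in_set_zip nth_mem prod.collapse set_rotate1)
  have sub: "(set ?p)\<^sup>s \<subseteq> set xs \<times> set xs"
    using ends by (fastforce simp: symcl_def)
  have p_arcs: "set ?p \<subseteq> parcs G"
    using ends arcs by (force simp: symcl_def)
  have cas: "pre_digraph.cas (with_proj G) x ?p x"
    using cas_zip_successors[of G x ys x] by (simp add: xs)
  have "pre_digraph.awalk_verts (with_proj G) x ?p = map fst ?p @ [snd (last ?p)]"
    by (subst pre_digraph.awalk_verts_conv) (simp add: xs)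
  moreover have "last (rotate1 xs) = x" by (simp add: xs)
  moreover have "snd (last ?p) = last (rotate1 xs)"
    using snd_p by (metis last_map assms(1) map_is_Nil_conv rotate1_is_Nil_conv)
  ultimately have "tl (pre_digraph.awalk_verts (with_proj G) x ?p) = rotate1 xs"
    unfolding fst_p by (simp add: xs)
  then have "pre_digraph.cycle (with_proj G) ?p"
    unfolding pre_digraph.cycle_def pre_digraph.awalk_def
    using cas p_arcs assms(2,3) by (intro exI[of _ x]) (auto simp: xs)
  moreover have "fst ` set ?p = set xs" using fst_p by (metis set_map)
  then have "arcs (with_proj G \<restriction> (fst ` set ?p)) = (set ?p)\<^sup>s"
    using sub arcs by auto
  ultimately show ?thesis unfolding induced_cycle_def ..
qed

text \<open>
  Walking round an induced cycle forever turns it into a sequence of vertices indexed by the natural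
  numbers, so that arguments about neighbours need no case distinction at the base point. Of the
  absence of chords only the part at distance two is kept. It needs length at least four: in
  a triangle, vertices at distance two are adjacent.
\<close>

lemma long_induced_cycleE:
  assumes "induced_cycle G p" "4 \<le> length p"
  obtains f :: "nat \<Rightarrow> 'a" where "\<And>i. (f i, f (Suc i)) \<in> parcs G"
    and "\<And>i. f (i + 2) \<noteq> f i" and "\<And>i. (f i, f (i + 2)) \<notin> parcs G"
proof -
  interpret H: pair_pre_digraph G .
  define k where "k = length p"
  have k: "4 \<le> k" using assms(2) by (simp add: k_def)
  have p_ne: "p \<noteq> []" using k by (auto simp: k_def)
  obtain u where pG: "set p \<subseteq> parcs G" and cas: "pcas u p u"
    and dist: "distinct (tl (pawalk_verts u p))"
    using assms(1) unfolding induced_cycle_def H.cycle_def H.awalk_def by auto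
  have ind: "\<And>a b. (a, b) \<in> parcs G \<Longrightarrow> a \<in> fst ` set p \<Longrightarrow> b \<in> fst ` set p \<Longrightarrow> (a, b) \<in> (set p)\<^sup>s"
    using assms(1) unfolding induced_cycle_def by (metis (mono_tags, lifting) mem_Collect_eq fst_conv
      induce_subgraph_arcs snd_conv with_proj_simps(2,4,5))
  have v1: "pawalk_verts u p = map fst p @ [snd (last p)]"
    using H.awalk_verts_conv[of u p] p_ne by simp
  have v2: "pawalk_verts u p = fst (hd p) # map snd p"
    using H.awalk_verts_conv'[OF cas] p_ne by simp
  \<comment> \<open>The heads of the arcs are exactly the vertices that the definition of a cycle declares distinct.\<close>
  define f where "f = (\<lambda>i. snd (p ! (i mod k)))"
  have inj: "f i = f j \<longleftrightarrow> i mod k = j mod k" for i j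
  proof -
    have "i mod k < length p" "j mod k < length p"
      using k mod_less_divisor[of k] by (simp_all flip: k_def)
    then show ?thesis
      using dist nth_eq_iff_index_eq[of "map snd p" "i mod k" "j mod k"] unfolding v2 f_def by simp
  qed
  have fst_eq: "fst (p ! (Suc i mod k)) = f i" for i
  proof (cases "Suc (i mod k) = k")
    case True
    have last_arc: "pcas x q y \<Longrightarrow> q \<noteq> [] \<Longrightarrow> snd (last q) = y" for x y q
      by (induction q arbitrary: x) auto
    have first_arc: "pcas x q y \<Longrightarrow> q \<noteq> [] \<Longrightarrow> fst (q ! 0) = x" for x y q
      by (cases q) simp_all
    have "i mod k = length p - 1" using True k_def by simp
    then have "f i = snd (last p)" using last_conv_nth[OF p_ne] by (simp only: f_def)
    also have "\<dots> = u" using last_arc[OF cas p_ne] .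
    also have "\<dots> = fst (p ! 0)" using first_arc[OF cas p_ne] by simp
    also have "0 = Suc i mod k" using True by (simp add: mod_Suc)
    finally show ?thesis by simp
  next
    case False
    then have m: "Suc i mod k = Suc (i mod k)" by (simp add: mod_Suc)
    have lt: "Suc (i mod k) < k" using False k mod_less_divisor[of k i] by linarith
    have "pawalk_verts u p ! Suc (i mod k) = fst (p ! Suc (i mod k))"
      unfolding v1 using lt by (simp add: nth_append k_def)
    moreover have "pawalk_verts u p ! Suc (i mod k) = snd (p ! (i mod k))"
      unfolding v2 using lt by (simp add: k_def)
    ultimately show ?thesis by (simp add: m f_def)
  qed
  have p_nth: "p ! (Suc i mod k) = (f i, f (Suc i))" for i
    using fst_eq[of i] by (simp add: f_def prod_eq_iff)
  have p_in: "(f i, f (Suc i)) \<in> set p" for i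
    using nth_mem[of "Suc i mod k" p] mod_less_divisor[of k "Suc i"] k
    by (simp only: p_nth flip: k_def)
  have in_p: "\<exists>j. e = (f j, f (Suc j))" if "e \<in> set p" for e
  proof -
    from that obtain j where j: "j < k" "e = p ! j" by (auto simp: in_set_conv_nth k_def)
    have "Suc (j + (k - 1)) mod k = j" using j k by simp
    then show ?thesis using p_nth[of "j + (k - 1)"] j(2) by metis
  qed
  show thesis
  proof
    show "(f i, f (Suc i)) \<in> parcs G" for i using p_in pG by blast
    show "f (i + 2) \<noteq> f i" for i
    proof
      assume "f (i + 2) = f i"
      then have "k dvd (i + 2) - i" unfolding inj by (intro mod_eq_dvd_iff_nat[THEN iffD1]) auto
      then show False using k by (auto dest: dvd_imp_le)
    qed
    show "(f i, f (i + 2)) \<notin> parcs G" for i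
    proof
      assume "(f i, f (i + 2)) \<in> parcs G"
      then have "(f i, f (i + 2)) \<in> (set p)\<^sup>s"
        using ind p_in by (metis fst_conv image_eqI)
      then have "(f i, f (i + 2)) \<in> set p \<or> (f (i + 2), f i) \<in> set p"
        by (auto simp: symcl_def)
      then consider j where "f i = f j" "f (i + 2) = f (Suc j)" | j where "f (i + 2) = f j" "f i = f (Suc j)"
        using in_p by blast
      then show False
      proof cases
        case 1
        \<comment> \<open>the chord would be an arc of the cycle in the forward direction, so \<open>k\<close> divides 1\<close>
        then have "(Suc i) mod k = (i + 2) mod k" unfolding inj by (metis mod_Suc_eq)
        then have "k dvd (i + 2) - Suc i" by (intro mod_eq_dvd_iff_nat[THEN iffD1]) auto
        then show False using k by simp
      next
        case 2
        \<comment> \<open>the chord would be an arc of the cycle in the backward direction, so \<open>k\<close> divides 3\<close>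
        then have "Suc (i + 2) mod k = i mod k" unfolding inj by (metis mod_Suc_eq)
        then have "k dvd Suc (i + 2) - i" by (intro mod_eq_dvd_iff_nat[THEN iffD1]) auto
        then show False using k by (auto dest!: dvd_imp_le)
      qed
    qed
  qed
qed

section \<open>The power order and its comparability graph\<close>

definition power_of :: "('a, 'b) monoid_scheme \<Rightarrow> 'a \<Rightarrow> 'a \<Rightarrow> bool" where
  "power_of G a b \<longleftrightarrow> (\<exists>m::nat. 0 < m \<and> a = b [^]\<^bsub>G\<^esub> m)"

lemma arcs_power_graph:
  "(a, b) \<in> parcs (power_graph G) \<longleftrightarrow>
     a \<in> carrier G \<and> b \<in> carrier G \<and> a \<noteq> b \<and> (power_of G a b \<or> power_of G b a)"
  by (auto simp: power_graph_def power_of_def)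

text \<open>
  The power graph is the comparability graph of the preorder \<open>power_of G\<close>. Its transitivity is what
  drives the analysis of induced cycles.
\<close>

lemma (in monoid) power_of_trans:
  assumes "power_of G a b" "power_of G b c" "c \<in> carrier G"
  shows "power_of G a c"
  using assms unfolding power_of_def by (metis nat_pow_pow nat_0_less_mult_iff)

text \<open>
  In a finite group the exponent zero may be replaced by the order of the element, so every natural
  exponent yields an element below \<open>b\<close>.
\<close>

lemma (in group) power_ofI:
  assumes "finite (carrier G)" "b \<in> carrier G" "a = b [^] (m::nat)"
  shows "power_of G a b"
proof -
  have "a = b [^] (m + ord b)" using assms by (simp add: nat_pow_mult[symmetric] pow_ord_eq_1)
  moreover have "0 < m + ord b" using ord_ge_1[OF assms(1,2)] by simp
  ultimately show ?thesis unfolding power_of_def by blast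
qed

text \<open>
  By transitivity of \<open>power_of G\<close>, three consecutive vertices of an induced cycle of length at least
  four cannot be ordered monotonically, so the cycle alternates between vertices that lie above both
  neighbours and vertices that lie below both. Let \<open>v\<close> be above its neighbours \<open>u\<close> and \<open>w\<close>. Whichever of
  the two is chosen as \<open>x\<close>, the other neighbour of \<open>x\<close> on the cycle is again above \<open>x\<close> but
  incomparable to \<open>v\<close>. The hypothesis rules this out for one choice of \<open>x\<close>.
\<close>

lemma (in monoid) chordal_power_graphI:
  assumes chain: "\<And>u v w. \<lbrakk>u \<in> carrier G; v \<in> carrier G; w \<in> carrier G;
      power_of G u v; power_of G w v; \<not> power_of G u w; \<not> power_of G w u\<rbrakk> \<Longrightarrow>
      \<exists>x\<in>{u, w}. \<forall>y\<in>carrier G. power_of G x y \<longrightarrow> power_of G v y \<or> power_of G y v"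
  shows "chordal (power_graph G)"
  unfolding chordal_def
proof
  assume "\<exists>p. induced_cycle (power_graph G) p \<and> 4 \<le> length p"
  then obtain p where "induced_cycle (power_graph G) p" "4 \<le> length p" by blast
  then obtain f :: "nat \<Rightarrow> 'a"
    where arc: "\<And>i. (f i, f (Suc i)) \<in> parcs (power_graph G)"
      and ne: "\<And>i. f (i + 2) \<noteq> f i" and no_arc: "\<And>i. (f i, f (i + 2)) \<notin> parcs (power_graph G)"
    using long_induced_cycleE by metis
  have fG: "f i \<in> carrier G" for i using arc[of i] by (simp add: arcs_power_graph)
  have adj: "power_of G (f i) (f (Suc i)) \<or> power_of G (f (Suc i)) (f i)" for i
    using arc[of i] by (simp add: arcs_power_graph)
  have nadj: "\<not> power_of G (f i) (f (Suc (Suc i)))" "\<not> power_of G (f (Suc (Suc i))) (f i)" for i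
    using ne[of i] no_arc[of i] fG by (auto simp: arcs_power_graph)
  have "\<exists>s. power_of G (f (Suc s)) (f (Suc (Suc s))) \<and> power_of G (f (Suc (Suc (Suc s)))) (f (Suc (Suc s)))"
  proof (cases "power_of G (f 1) (f (Suc 1))")
    case True
    then have "\<not> power_of G (f (Suc 1)) (f (Suc (Suc 1)))"
      using nadj(1)[of 1] power_of_trans[OF _ _ fG] by blast
    then show ?thesis using True adj[of "Suc 1"] by (intro exI[of _ 0]) simp
  next
    case False
    then have "power_of G (f (Suc 1)) (f 1)" using adj[of 1] by blast
    then have "\<not> power_of G (f (Suc (Suc 1))) (f (Suc 1))"
      using nadj(2)[of 1] power_of_trans[OF _ _ fG] by blast
    then have up: "power_of G (f (Suc 1)) (f (Suc (Suc 1)))" using adj[of "Suc 1"] by blast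
    then have "\<not> power_of G (f (Suc (Suc 1))) (f (Suc (Suc (Suc 1))))"
      using nadj(1)[of "Suc 1"] power_of_trans[OF _ _ fG] by blast
    then show ?thesis using up adj[of "Suc (Suc 1)"] by (intro exI[of _ 1]) simp
  qed
  then obtain s where s: "power_of G (f (Suc s)) (f (Suc (Suc s)))"
    "power_of G (f (Suc (Suc (Suc s)))) (f (Suc (Suc s)))" by blast
  obtain x where x: "x \<in> {f (Suc s), f (Suc (Suc (Suc s)))}"
    and above: "\<And>y. y \<in> carrier G \<Longrightarrow> power_of G x y \<Longrightarrow>
      power_of G (f (Suc (Suc s))) y \<or> power_of G y (f (Suc (Suc s)))"
    using chain[OF fG fG fG s nadj(1) nadj(2)] by blast
  \<comment> \<open>\<open>y\<close> is meant to be the neighbour of \<open>x = f t\<close> on the cycle other than \<open>f (s + 2)\<close>\<close>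
  have nbr: False if "x = f t" "power_of G (f t) y \<or> power_of G y (f t)" "power_of G (f t) (f (Suc (Suc s)))"
    "y \<in> carrier G" "\<not> power_of G y (f (Suc (Suc s)))" "\<not> power_of G (f (Suc (Suc s))) y" for t y
    using that above[of y] power_of_trans[of y "f t"] power_of_trans[of "f t" y] fG by blast
  show False
    using x
  proof (elim insertE emptyE)
    assume "x = f (Suc s)"
    then show False using nbr[of "Suc s" "f s"] adj[of s] nadj[of s] s fG by blast
  next
    assume "x = f (Suc (Suc (Suc s)))"
    then show False
      using nbr[of "Suc (Suc (Suc s))" "f (Suc (Suc (Suc (Suc s))))"] adj[of "Suc (Suc (Suc s))"]
        nadj[of "Suc (Suc s)"] s fG by blast
  qed
qed

section \<open>Centralizers of elements of prime order in small symmetric groups\<close>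

text \<open>
  The length of an orbit of \<open>g\<close> divides \<open>p\<close>, so an orbit with more than one point has exactly \<open>p\<close> points.
\<close>

lemma card_orbit_prime_root:
  assumes "permutation g" "prime p" "g ^^ p = id" "g a \<noteq> a"
  shows "card (range (\<lambda>i. (g ^^ i) a)) = p"
proof -
  have "least_power g a dvd p" using assms by (simp add: least_power_dvd)
  moreover have "least_power g a \<noteq> 1" using least_power_gt_one[OF assms(1,4)] by simp
  ultimately have "least_power g a = p" using assms(2) by (auto simp: prime_nat_iff)
  then have "length (support g a) = p" by simp
  then show ?thesis
    using cycle_of_permutation[OF assms(1), of a] distinct_card support_set[OF assms(1), of a] by metis
qed

lemma commute_funpow_apply:
  assumes "v \<circ> g = g \<circ> v"
  shows "v ((g ^^ k) x) = (g ^^ k) (v x)"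
  by (induction k) (use assms in \<open>simp_all add: fun_eq_iff\<close>)

text \<open>
  On an orbit of \<open>g\<close>, a map commuting with \<open>g\<close> is determined by its value at one point. This is the
  source of all centralizer computations below.
\<close>

lemma commute_eq_funpow_on_orbit:
  assumes "v \<circ> g = g \<circ> v" "v a = (g ^^ i) a" "x \<in> range (\<lambda>k. (g ^^ k) a)"
  shows "v x = (g ^^ i) x"
proof -
  obtain k where x: "x = (g ^^ k) a" using assms(3) by blast
  have "v x = (g ^^ k) ((g ^^ i) a)" using commute_funpow_apply[OF assms(1)] assms(2) x by simp
  also have "\<dots> = (g ^^ i) x" unfolding x by (metis add.commute comp_apply funpow_add)
  finally show ?thesis .
qed

lemma orbit_subset:
  assumes "g permutes A" "a \<in> A"
  shows "range (\<lambda>i. (g ^^ i) a) \<subseteq> A"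
proof -
  have "(g ^^ i) a \<in> A" for i
    by (induction i) (use assms in \<open>simp_all add: permutes_in_image\<close>)
  then show ?thesis by blast
qed

lemma permutes_funpow_outside: "g permutes A \<Longrightarrow> x \<notin> A \<Longrightarrow> (g ^^ i) x = x"
  by (induction i) (simp_all add: permutes_not_in)

lemma permutes_funpow: "g permutes A \<Longrightarrow> (g ^^ i) permutes A"
  by (induction i) (simp_all add: permutes_compose permutes_id[unfolded id_def[symmetric]])

lemma moved_pointE:
  assumes "g permutes A" "g \<noteq> id"
  obtains a where "a \<in> A" "g a \<noteq> a"
  using assms by (metis eq_id_iff permutes_not_in)

text \<open>
  Five points leave room for a single orbit of length five, so \<open>g\<close> acts transitively on \<open>A\<close> and the value of
  \<open>v\<close> at one point already exhibits \<open>v\<close> as a power of \<open>g\<close>.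
\<close>

lemma centralizer_five_cycle:
  assumes "finite A" "card A \<le> 5" "g permutes A" "g ^^ 5 = id" "g \<noteq> id"
    and "v permutes A" "v \<circ> g = g \<circ> v"
  shows "\<exists>i. v = g ^^ i"
proof -
  obtain a where a: "a \<in> A" "g a \<noteq> a" using assms(3,5) moved_pointE by metis
  let ?O = "range (\<lambda>i. (g ^^ i) a)"
  have "permutation g" using assms(1,3) permutation_permutes by blast
  then have "card ?O = 5" using card_orbit_prime_root[where p = 5] a(2) assms(4) by simp
  then have OA: "?O = A"
    using orbit_subset[OF assms(3) a(1)] assms(1,2) card_subset_eq card_mono by (metis le_antisym)
  have "v a \<in> ?O" unfolding OA using a(1) assms(6) by (simp add: permutes_in_image)
  then obtain i where "v a = (g ^^ i) a" by blast
  then have "v x = (g ^^ i) x" for x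
    using commute_eq_funpow_on_orbit[OF assms(7), of a i x] OA assms(3,6)
      permutes_funpow_outside permutes_not_in by metis
  then show ?thesis by blast
qed

lemma permutes_card_le_2:
  assumes "finite R" "card R \<le> 2"
  shows "\<exists>\<tau>. \<tau> permutes R \<and> \<tau> \<circ> \<tau> = id \<and> (\<forall>w. w permutes R \<longrightarrow> w = id \<or> w = \<tau>)"
proof (cases "card R = 2")
  case True
  then obtain d e where R: "R = {d, e}" by (meson card_2_iff)
  show ?thesis unfolding R
    by (intro exI[of _ "transpose d e"]) (simp add: permutes_doubleton_iff)
next
  case False
  then consider "R = {}" | d where "R = {d}" using assms
    by (metis card_0_eq card_1_singletonE le_SucE le_zero_eq numeral_2_eq_2 One_nat_def)
  then show ?thesis by cases auto
qed

text \<open>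
  Two orbits of length three do not fit into five points, so \<open>c\<close> is a single 3-cycle on a set of
  three points and fixes the at most two remaining points \<open>R\<close>. A permutation commuting with \<open>c\<close> preserves
  both parts, is a power of \<open>c\<close> on the first, and is trivial or the swap \<open>\<tau>\<close> on the second.
  If \<open>R\<close> has fewer than two points, \<open>\<tau>\<close> is the identity.
\<close>

lemma centralizer_three_cycle:
  assumes "finite A" "card A \<le> 5" "c permutes A" "c ^^ 3 = id" "c \<noteq> id"
  shows "\<exists>\<tau>. \<tau> permutes A \<and> \<tau> \<circ> \<tau> = id \<and> \<tau> \<circ> c = c \<circ> \<tau> \<and>
    (\<forall>v. v permutes A \<longrightarrow> v \<circ> c = c \<circ> v \<longrightarrow> (\<exists>i. v = c ^^ i \<or> v = c ^^ i \<circ> \<tau>))"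
proof -
  have perm: "permutation c" using assms(1,3) permutation_permutes by blast
  have c3: "c ^^ (3 * i) = id" for i
    using funpow_mult[where m = 3 and n = i and f = c] assms(4) by simp
  have cancel: "(c ^^ (2 * i)) ((c ^^ i) x) = x" for i x
  proof -
    have "c ^^ (2 * i) \<circ> c ^^ i = c ^^ (3 * i)" by (simp flip: funpow_add)
    then show ?thesis using c3 by (metis comp_apply id_apply)
  qed
  obtain a where a: "a \<in> A" "c a \<noteq> a" using assms(3,5) moved_pointE by metis
  define O' where "O' = range (\<lambda>i. (c ^^ i) a)"
  define R where "R = A - O'"
  have cardO: "card O' = 3" unfolding O'_def
    using card_orbit_prime_root[OF perm, where p = 3] a(2) assms(4) by simp
  have OA: "O' \<subseteq> A" unfolding O'_def by (rule orbit_subset[OF assms(3) a(1)])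
  have R: "finite R" "card R \<le> 2"
    unfolding R_def using cardO OA assms(1,2) by (auto simp: card_Diff_subset finite_subset)
  have fixR: "c x = x" if "x \<in> R" for x
  proof (rule ccontr)
    assume x: "c x \<noteq> x"
    let ?P = "range (\<lambda>i. (c ^^ i) x)"
    have cardP: "card ?P = 3" using card_orbit_prime_root[OF perm, where p = 3] x assms(4) by simp
    have PA: "?P \<subseteq> A" using orbit_subset[OF assms(3)] that by (simp add: R_def)
    have "?P \<inter> O' = {}"
    proof (rule ccontr)
      assume "?P \<inter> O' \<noteq> {}"
      then obtain i j where "(c ^^ i) x = (c ^^ j) a" unfolding O'_def by blast
      then have "x = (c ^^ (2 * i + j)) a" using cancel[of i x] by (simp add: funpow_add)
      then show False using that by (simp add: R_def O'_def)
    qed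
    moreover have "finite ?P" "finite O'" using PA OA assms(1) finite_subset by blast+
    ultimately have "card (?P \<union> O') = 6" using cardP cardO by (simp add: card_Un_disjoint)
    moreover have "card (?P \<union> O') \<le> card A" using PA OA assms(1) by (intro card_mono) auto
    ultimately show False using assms(2) by simp
  qed
  obtain \<tau> where \<tau>: "\<tau> permutes R" "\<tau> \<circ> \<tau> = id" and two: "\<And>w. w permutes R \<Longrightarrow> w = id \<or> w = \<tau>"
    using permutes_card_le_2[OF R] by blast
  have "\<tau> permutes A" using permutes_subset[OF \<tau>(1)] by (simp add: R_def)
  moreover have "\<tau> \<circ> c = c \<circ> \<tau>"
  proof
    fix x
    show "(\<tau> \<circ> c) x = (c \<circ> \<tau>) x"
    proof (cases "x \<in> R")
      case True
      then show ?thesis using fixR \<tau>(1) by (simp add: permutes_in_image)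
    next
      case False
      then have "c x \<notin> R" using fixR permutes_inj[OF assms(3)] by (metis injD)
      then show ?thesis using False \<tau>(1) by (simp add: permutes_not_in)
    qed
  qed
  moreover have "\<exists>i. v = c ^^ i \<or> v = c ^^ i \<circ> \<tau>" if v: "v permutes A" "v \<circ> c = c \<circ> v" for v
  proof -
    have "v a \<notin> R"
    proof
      assume "v a \<in> R"
      then have "v (c a) = v a" using fixR v(2) by (metis comp_apply)
      then show False using a(2) permutes_inj[OF v(1)] by (metis injD)
    qed
    then have "v a \<in> O'" using a(1) v(1) by (simp add: R_def permutes_in_image)
    then obtain i where "v a = (c ^^ i) a" unfolding O'_def by blast
    then have onO: "v x = (c ^^ i) x" if "x \<in> O'" for x
      using commute_eq_funpow_on_orbit[OF v(2)] that unfolding O'_def by blast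
    \<comment> \<open>Since \<open>c\<close> has order 3, \<open>c ^^ (2 * i)\<close> inverts \<open>c ^^ i\<close>, and \<open>w\<close> is the part of \<open>v\<close> acting on \<open>R\<close>.\<close>
    define w where "w = c ^^ (2 * i) \<circ> v"
    have "c ^^ (2 * i) permutes A" using permutes_funpow[OF assms(3)] .
    then have "w permutes A" unfolding w_def using v(1) by (intro permutes_compose)
    then have "w permutes R"
      by (rule permutes_superset) (simp add: R_def w_def onO cancel)
    then have "w = id \<or> w = \<tau>" by (rule two)
    moreover have "v = c ^^ i \<circ> w"
    proof -
      have "c ^^ i \<circ> w = c ^^ (3 * i) \<circ> v"
        unfolding w_def by (simp add: comp_assoc[symmetric] flip: funpow_add)
      then show ?thesis using c3 by simp
    qed
    ultimately show ?thesis by auto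
  qed
  ultimately show ?thesis using \<tau>(2) by blast
qed


section \<open>Symmetric groups on at most five letters\<close>

text \<open>
  A cyclic group has exactly one subgroup of each order, ordered by divisibility of the orders. In
  terms of exponents, \<open>w = v [^] j\<close> generates the same subgroup as \<open>v [^] gcd j (ord v)\<close>, and divisibility of the
  orders forces this gcd to divide the exponent of \<open>u\<close>.
\<close>

lemma (in group) power_of_if_ord_dvd:
  assumes "finite (carrier G)" "v \<in> carrier G" "power_of G u v" "power_of G w v"
    and dvd: "ord u dvd ord w"
  shows "power_of G u w"
proof -
  obtain i j :: nat where i: "0 < i" "u = v [^] i" and j: "0 < j" "w = v [^] j"
    using assms(3,4) unfolding power_of_def by blast
  define N where "N = ord v"
  have N: "0 < N" using ord_ge_1[OF assms(1,2)] by (simp add: N_def)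
  have "N div gcd N i dvd N div gcd N j"
    using dvd i j ord_pow_gen[OF assms(2)] by (simp add: N_def)
  then obtain k where "N div gcd N j = N div gcd N i * k" by blast
  then have "(N div gcd N j) * gcd N j * gcd N i = (N div gcd N i) * gcd N i * k * gcd N j"
    by (simp add: ac_simps)
  then have "gcd N i = k * gcd N j" using N by simp
  then have "gcd j N dvd i" by (metis dvd_trans dvd_triv_right gcd.commute gcd_dvd2)
  then obtain q where q: "i = gcd j N * q" by blast
  obtain x y where "j * x = N * y + gcd j N" using bezout_nat[of j N] j(1) by auto
  then have "v [^] (j * x) = v [^] (N * y) \<otimes> v [^] gcd j N"
    using assms(2) by (simp add: nat_pow_mult)
  also have "v [^] (N * y) = \<one>" using assms(2) by (simp add: pow_eq_id N_def)
  finally have "v [^] gcd j N = w [^] x" using assms(2) j(2) by (simp add: nat_pow_pow)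
  then have "u = w [^] (x * q)"
    using i(2) q assms(2) j(2) by (metis nat_pow_closed nat_pow_pow)
  then show ?thesis using power_ofI[OF assms(1)] assms(2) j(2) by simp
qed

text \<open>
  In the situation of a 3-cycle and its centralizer, the elements having \<open>c\<close> as a power form a chain.
  An element \<open>c [^] i\<close> is a power of anything above \<open>c\<close>. If \<open>v = c [^] i \<otimes> \<tau>\<close> lies
  above \<open>c\<close>, then \<open>\<tau>\<close> is a power of \<open>v\<close> as well, so every \<open>c [^] j \<otimes> \<tau>\<close> is one.
\<close>

lemma (in group) power_of_comparable_cyclic_times_involution:
  fixes i j :: nat
  assumes "finite (carrier G)" "c \<in> carrier G" "\<tau> \<in> carrier G"
    and c3: "c [^] (3::nat) = \<one>"
    and v: "v \<in> carrier G" "power_of G c v" "v = c [^] i \<or> v = c [^] i \<otimes> \<tau>"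
    and y: "y \<in> carrier G" "power_of G c y" "y = c [^] j \<or> y = c [^] j \<otimes> \<tau>"
  shows "power_of G v y \<or> power_of G y v"
proof -
  have below: "power_of G (c [^] k) z" if "z \<in> carrier G" "power_of G c z" for z and k :: nat
    using power_of_trans[OF power_ofI[OF assms(1,2) refl] that(2,1)] .
  show ?thesis
  proof (cases "v = c [^] i \<or> y = c [^] j")
    case True
    then show ?thesis using below[OF v(1,2)] below[OF y(1,2)] by auto
  next
    case False
    then have v_eq: "v = c [^] i \<otimes> \<tau>" and y_eq: "y = c [^] j \<otimes> \<tau>" using v(3) y(3) by auto
    obtain m :: nat where m: "c = v [^] m" using v(2) unfolding power_of_def by blast
    have "c [^] (2 * i) \<otimes> c [^] i = (c [^] (3::nat)) [^] i"
      using assms(2) by (simp add: nat_pow_mult nat_pow_pow)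
    then have c3i: "c [^] (2 * i) \<otimes> c [^] i = \<one>" using c3 by simp
    have "\<tau> = c [^] (2 * i) \<otimes> v"
      unfolding v_eq using assms(2,3) c3i by (simp flip: m_assoc)
    then have "y = c [^] (j + 2 * i) \<otimes> v"
      unfolding y_eq using assms(2) v(1) by (simp add: m_assoc flip: nat_pow_mult)
    also have "\<dots> = v [^] (m * (j + 2 * i) + 1)"
      using v(1) by (simp add: m nat_pow_pow nat_pow_mult)
    finally show ?thesis using power_ofI[OF assms(1) v(1)] by blast
  qed
qed

lemma sym_group_nat_pow: "p [^]\<^bsub>sym_group n\<^esub> (k::nat) = p ^^ k"
proof (induction k)
  case 0
  then show ?case by (simp add: sym_group_one)
next
  case (Suc k)
  then show ?case by (simp add: sym_group_mult funpow_Suc_right del: funpow.simps)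
qed

lemma power_of_commute:
  assumes "power_of (sym_group n) c v"
  shows "v \<circ> c = c \<circ> v"
  using assms unfolding power_of_def
  by (auto simp: sym_group_nat_pow simp flip: funpow_Suc_right)

lemma finite_sym_group: "finite (carrier (sym_group n))"
  by (simp add: sym_group_def finite_permutations)

lemma sym_group_three_cycle_centralizer:
  assumes "n \<le> 5" "c \<in> carrier (sym_group n)" "group.ord (sym_group n) c = 3"
  obtains \<tau> where "\<tau> \<in> carrier (sym_group n)" "\<tau> \<circ> \<tau> = id" "\<tau> \<circ> c = c \<circ> \<tau>"
    and "\<And>v. v \<in> carrier (sym_group n) \<Longrightarrow> power_of (sym_group n) c v \<Longrightarrow>
      \<exists>i. v = c ^^ i \<or> v = c ^^ i \<circ> \<tau>"
proof -
  interpret group "sym_group n" by (rule sym_group_is_group)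
  have "c ^^ 3 = id" "c \<noteq> id"
    using assms(2,3) pow_ord_eq_1[OF assms(2)] ord_eq_1[OF assms(2)]
    by (auto simp: sym_group_nat_pow sym_group_one)
  moreover have "c permutes {1..n}" using assms(2) by (simp add: sym_group_carrier)
  ultimately show thesis
    using centralizer_three_cycle[of "{1..n}" c] assms(1) that power_of_commute
    by (auto simp: sym_group_carrier) metis
qed

lemma sym_group_chain_above_three_cycle:
  assumes "n \<le> 5" "c \<in> carrier (sym_group n)" "group.ord (sym_group n) c = 3"
    and "v \<in> carrier (sym_group n)" "power_of (sym_group n) c v"
    and "y \<in> carrier (sym_group n)" "power_of (sym_group n) c y"
  shows "power_of (sym_group n) v y \<or> power_of (sym_group n) y v"
proof -
  interpret group "sym_group n" by (rule sym_group_is_group)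
  obtain \<tau> where \<tau>: "\<tau> \<in> carrier (sym_group n)"
    and C: "\<And>v. v \<in> carrier (sym_group n) \<Longrightarrow> power_of (sym_group n) c v \<Longrightarrow>
      \<exists>i. v = c ^^ i \<or> v = c ^^ i \<circ> \<tau>"
    using sym_group_three_cycle_centralizer[OF assms(1-3)] by metis
  obtain i j where "v = c ^^ i \<or> v = c ^^ i \<circ> \<tau>" "y = c ^^ j \<or> y = c ^^ j \<circ> \<tau>"
    using C assms(4-7) by metis
  then show ?thesis
    using power_of_comparable_cyclic_times_involution[OF finite_sym_group assms(2) \<tau> _ assms(4,5) _ assms(6,7), of i j]
      pow_ord_eq_1[OF assms(2)] assms(3)
    by (simp add: sym_group_nat_pow sym_group_mult)
qed

lemma (in group) ord_pow_div:
  assumes "finite (carrier G)" "v \<in> carrier G" "p dvd ord v"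
  shows "ord (v [^] (ord v div p)) = p"
proof -
  have "0 < ord v" using ord_ge_1[OF assms(1,2)] by simp
  obtain q where q: "ord v = p * q" using assms(3) by blast
  then have "0 < p" "0 < q" using \<open>0 < ord v\<close> by (auto intro: gr0I)
  then show ?thesis using ord_pow_gen[OF assms(2), of "ord v div p"] q by simp
qed

text \<open>
  The order \<open>N\<close> of \<open>v\<close> divides \<open>5!\<close>, which is 120. If 5 or 3 divides \<open>N\<close>, a power of \<open>v\<close> has that order, and the
  centralizer of this power, which contains \<open>v\<close>, has exponent dividing 5 or 6 respectively.
  Otherwise \<open>N\<close> is coprime to 15 and divides 8. The bounds 5 and 8 are prime powers,
  whose divisors form a chain, so incomparable powers of one element occur only for the order 6.
\<close>

lemma ord_sym_group_le_5_dvd: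
  assumes "n \<le> 5" "v \<in> carrier (sym_group n)"
  shows "group.ord (sym_group n) v dvd 5 \<or> group.ord (sym_group n) v dvd 6 \<or>
    group.ord (sym_group n) v dvd 8"
proof -
  interpret group "sym_group n" by (rule sym_group_is_group)
  define N where "N = ord v"
  have pow_in: "v [^]\<^bsub>sym_group n\<^esub> k \<in> carrier (sym_group n)" for k :: nat
    using assms(2) by simp
  have power_v: "power_of (sym_group n) (v [^]\<^bsub>sym_group n\<^esub> k) v" for k :: nat
    using power_ofI[OF finite_sym_group assms(2)] by blast
  have N120: "N dvd 120"
  proof -
    have "N dvd fact n"
      using ord_dvd_group_order[OF assms(2)] unfolding N_def order_def sym_group_card_carrier .
    also have "fact n dvd (fact 5 :: nat)" using assms(1) by (rule fact_dvd)
    finally show ?thesis by (simp add: eval_nat_numeral)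
  qed
  consider "5 dvd N" | "3 dvd N" | "\<not> 5 dvd N" "\<not> 3 dvd N" by blast
  then show ?thesis
  proof cases
    case 1
    define g where "g = v [^]\<^bsub>sym_group n\<^esub> (N div 5)"
    have "ord g = 5" using ord_pow_div[OF finite_sym_group assms(2)] 1 by (simp add: g_def N_def)
    have gG: "g \<in> carrier (sym_group n)" using pow_in by (simp add: g_def)
    have g5: "g ^^ 5 = id" and "g \<noteq> id"
      using pow_ord_eq_1[OF gG] ord_eq_1[OF gG] \<open>ord g = 5\<close>
      by (auto simp: sym_group_nat_pow sym_group_one)
    then obtain i where "v = g ^^ i"
      using centralizer_five_cycle[of "{1..n}" g v] assms(1,2) gG power_of_commute[of n g v] power_v
      by (auto simp: sym_group_carrier g_def)
    then have "v ^^ 5 = (g ^^ 5) ^^ i" by (simp add: funpow_mult mult.commute)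
    then have "v [^]\<^bsub>sym_group n\<^esub> (5::nat) = \<one>\<^bsub>sym_group n\<^esub>"
      using g5 by (simp add: sym_group_nat_pow sym_group_one)
    then show ?thesis using pow_eq_id[OF assms(2), of 5] by simp
  next
    case 2
    define c where "c = v [^]\<^bsub>sym_group n\<^esub> (N div 3)"
    have ordc: "ord c = 3" using ord_pow_div[OF finite_sym_group assms(2)] 2 by (simp add: c_def N_def)
    have cG: "c \<in> carrier (sym_group n)" using pow_in by (simp add: c_def)
    have c3: "c [^]\<^bsub>sym_group n\<^esub> (3::nat) = \<one>\<^bsub>sym_group n\<^esub>"
      using pow_ord_eq_1[OF cG] ordc by simp
    obtain \<tau> where \<tau>: "\<tau> \<in> carrier (sym_group n)" "\<tau> \<circ> \<tau> = id" "\<tau> \<circ> c = c \<circ> \<tau>"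
      and "\<exists>i. v = c ^^ i \<or> v = c ^^ i \<circ> \<tau>"
      using sym_group_three_cycle_centralizer[OF assms(1) cG ordc] assms(2) power_v c_def by metis
    then obtain i where "v = c ^^ i \<or> v = c ^^ i \<circ> \<tau>" by (elim exE)
    then have v_eq: "v = c [^]\<^bsub>sym_group n\<^esub> i \<or> v = c [^]\<^bsub>sym_group n\<^esub> i \<otimes>\<^bsub>sym_group n\<^esub> \<tau>"
      by (simp only: sym_group_nat_pow sym_group_mult)
    have comm: "c [^]\<^bsub>sym_group n\<^esub> i \<otimes>\<^bsub>sym_group n\<^esub> \<tau> = \<tau> \<otimes>\<^bsub>sym_group n\<^esub> c [^]\<^bsub>sym_group n\<^esub> i"
      using commute_funpow_apply[OF \<tau>(3)] by (auto simp: sym_group_nat_pow sym_group_mult)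
    have c6: "(c [^]\<^bsub>sym_group n\<^esub> i) [^]\<^bsub>sym_group n\<^esub> (6::nat) = \<one>\<^bsub>sym_group n\<^esub>"
    proof -
      have "(c [^]\<^bsub>sym_group n\<^esub> i) [^]\<^bsub>sym_group n\<^esub> (6::nat)
          = (c [^]\<^bsub>sym_group n\<^esub> (3::nat)) [^]\<^bsub>sym_group n\<^esub> (2 * i)"
        using cG by (simp add: nat_pow_pow mult.commute)
      then show ?thesis using c3 by simp
    qed
    have \<tau>6: "\<tau> [^]\<^bsub>sym_group n\<^esub> (6::nat) = \<one>\<^bsub>sym_group n\<^esub>"
    proof -
      have "(\<tau> ^^ 2) ^^ 3 = id" using \<tau>(2) by (simp add: numeral_2_eq_2)
      then show ?thesis by (simp add: sym_group_nat_pow sym_group_one funpow_mult)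
    qed
    have "v [^]\<^bsub>sym_group n\<^esub> (6::nat) = \<one>\<^bsub>sym_group n\<^esub>"
      using v_eq c6 \<tau>6 pow_mult_distrib[OF comm _ \<tau>(1), of 6] cG by auto
    then show ?thesis using pow_eq_id[OF assms(2), of 6] by simp
  next
    case 3
    have "prime (5::nat)" "prime (3::nat)" by simp_all
    then have "coprime N 5" "coprime N 3"
      using 3 by (metis coprime_commute prime_imp_coprime)+
    then have "coprime N 15" using coprime_mult_right_iff[of N 3 5] by simp
    moreover have "N dvd 8 * 15" using N120 by simp
    ultimately show ?thesis using coprime_dvd_mult_left_iff N_def by blast
  qed
qed

lemma incomparable_divisors_of_5_6_8:
  fixes N u w :: nat
  assumes "N dvd 5 \<or> N dvd 6 \<or> N dvd 8" "u dvd N" "w dvd N" "\<not> u dvd w" "\<not> w dvd u"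
  shows "u = 3 \<or> w = 3"
proof -
  have dvds: "d dvd 5 \<Longrightarrow> d \<in> {1, 5}" "d dvd 6 \<Longrightarrow> d \<in> {1, 2, 3, 6}" "d dvd 8 \<Longrightarrow> d \<in> {1, 2, 4, 8}"
    for d :: nat
  proof -
    show "d \<in> {1, 5}" if "d dvd 5"
    proof -
      have "d \<le> 5" using dvd_imp_le[OF that] by simp
      then have "d \<in> {0, 1, 2, 3, 4, 5}" by auto
      then show ?thesis using that by auto
    qed
    show "d \<in> {1, 2, 3, 6}" if "d dvd 6"
    proof -
      have "d \<le> 6" using dvd_imp_le[OF that] by simp
      then have "d \<in> {0, 1, 2, 3, 4, 5, 6}" by auto
      then show ?thesis using that by auto
    qed
    show "d \<in> {1, 2, 4, 8}" if "d dvd 8"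
    proof -
      have "d \<le> 8" using dvd_imp_le[OF that] by simp
      then have "d \<in> {0, 1, 2, 3, 4, 5, 6, 7, 8}" by auto
      then show ?thesis using that by auto
    qed
  qed
  from assms(1) consider "N dvd 5" | "N dvd 6" | "N dvd 8" by blast
  then show ?thesis
  proof cases
    case 1
    then have "u \<in> {1, 5}" "w \<in> {1, 5}" using assms(2,3) dvds dvd_trans by metis+
    then show ?thesis using assms(4,5) by auto
  next
    case 2
    then have "u \<in> {1, 2, 3, 6}" "w \<in> {1, 2, 3, 6}" using assms(2,3) dvds dvd_trans by metis+
    then show ?thesis using assms(4,5) by auto
  next
    case 3
    then have "u \<in> {1, 2, 4, 8}" "w \<in> {1, 2, 4, 8}" using assms(2,3) dvds dvd_trans by metis+
    then show ?thesis using assms(4,5) by auto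
  qed
qed

text \<open>
  Of two incomparable powers of one permutation, one has order 3 and therefore is a 3-cycle.
  Any two elements above a 3-cycle are comparable, so the criterion for chordality applies.
\<close>

lemma chordal_power_graph_sym_group:
  assumes "n \<le> 5"
  shows "chordal (power_graph (sym_group n))"
proof -
  interpret group "sym_group n" by (rule sym_group_is_group)
  show ?thesis
  proof (rule chordal_power_graphI)
    fix u v w
    assume G: "u \<in> carrier (sym_group n)" "v \<in> carrier (sym_group n)" "w \<in> carrier (sym_group n)"
      and uv: "power_of (sym_group n) u v" and wv: "power_of (sym_group n) w v"
      and inc: "\<not> power_of (sym_group n) u w" "\<not> power_of (sym_group n) w u"
    have "ord z dvd ord v" if "power_of (sym_group n) z v" for z
      using that G(2) by (auto simp: power_of_def nat_pow_pow simp flip: pow_eq_id)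
        (simp add: pow_eq_id)
    then have "ord u dvd ord v" "ord w dvd ord v" using uv wv by blast+
    moreover have "\<not> ord u dvd ord w" "\<not> ord w dvd ord u"
      using power_of_if_ord_dvd[OF finite_sym_group G(2)] uv wv inc by blast+
    ultimately have "ord u = 3 \<or> ord w = 3"
      using incomparable_divisors_of_5_6_8[OF ord_sym_group_le_5_dvd[OF assms G(2)]] by blast
    then obtain x where "x \<in> {u, w}" "ord x = 3" by blast
    then show "\<exists>x\<in>{u, w}. \<forall>y\<in>carrier (sym_group n). power_of (sym_group n) x y \<longrightarrow>
        power_of (sym_group n) v y \<or> power_of (sym_group n) y v"
      using sym_group_chain_above_three_cycle[OF assms _ _ G(2)] G uv wv by blast
  qed
qed

section \<open>Symmetric groups on at least six letters\<close>

text \<open>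
  The cycle \<open>(i 5 6)\<close> for \<open>i\<close> in \<open>{2, 3, 4}\<close>; the index 0 stands for the identity, so that products with a
  trivial factor need no separate treatment.
\<close>

definition letter_cycle :: "nat \<Rightarrow> nat \<Rightarrow> nat" where
  "letter_cycle i = (if i = 0 then id else transpose i 5 \<circ> transpose 5 6)"

text \<open>
  The transposition \<open>(1 j)\<close> for \<open>j\<close> in \<open>{2, 3, 4}\<close>, again with index 0 for the identity. For \<open>i\<close>
  and \<open>j\<close> in this range it is disjoint from \<open>letter_cycle i\<close> precisely when \<open>i \<noteq> j\<close>.
\<close>

definition letter_swap :: "nat \<Rightarrow> nat \<Rightarrow> nat" where
  "letter_swap j = (if j = 0 then id else transpose 1 j)"

text \<open>
  Joining \<open>i\<close> to \<open>j\<close> when \<open>(i 5 6)\<close> and \<open>(1 j)\<close> commute gives the complete bipartite graph on two copies of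
  \<open>{2, 3, 4}\<close> minus a perfect matching, which is a hexagon. Inserting the product, of order 6, between each
  commuting pair subdivides the hexagon into a cycle of length 12. The label \<open>(i, j)\<close> stands for the
  product of \<open>(i 5 6)\<close> and \<open>(1 j)\<close>, and the labels are listed in the cyclic order.
\<close>

definition labels :: "(nat \<times> nat) list" where
  "labels = [(2, 0), (2, 3), (0, 3), (4, 3), (4, 0), (4, 2),
             (0, 2), (3, 2), (3, 0), (3, 4), (0, 4), (2, 4)]"

definition label_perm :: "nat \<times> nat \<Rightarrow> nat \<Rightarrow> nat" where
  "label_perm l = letter_cycle (fst l) \<circ> letter_swap (snd l)"

text \<open>
  The order on labels that mirrors the relation of being a power: each component is either trivial
  or the same.
\<close>

definition label_le :: "nat \<times> nat \<Rightarrow> nat \<times> nat \<Rightarrow> bool" where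
  "label_le l l' \<longleftrightarrow> (fst l = 0 \<or> fst l = fst l') \<and> (snd l = 0 \<or> snd l = snd l')"

lemma labels_adjacent_iff:
  assumes "l \<in> set labels" "l' \<in> set labels"
  shows "l \<noteq> l' \<and> (label_le l l' \<or> label_le l' l) \<longleftrightarrow> (l, l') \<in> (set (zip labels (rotate1 labels)))\<^sup>s"
proof -
  have "\<forall>l\<in>set labels. \<forall>l'\<in>set labels. l \<noteq> l' \<and> (label_le l l' \<or> label_le l' l) \<longleftrightarrow>
      (l, l') \<in> set (zip labels (rotate1 labels)) \<or> (l', l) \<in> set (zip labels (rotate1 labels))"
    by (simp add: labels_def label_le_def)
  moreover have "(a, b) \<in> R\<^sup>s \<longleftrightarrow> (a, b) \<in> R \<or> (b, a) \<in> R" for a b :: "nat \<times> nat" and R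
    by (auto simp: symcl_def)
  ultimately show ?thesis using assms by blast
qed

lemma labels_range:
  "l \<in> set labels \<Longrightarrow> fst l \<in> {0, 2, 3, 4} \<and> snd l \<in> {0, 2, 3, 4} \<and> (fst l = snd l \<longrightarrow> fst l = 0)"
  by (auto simp: labels_def)

lemma letter_cycle_cube: "i \<in> {0, 2, 3, 4} \<Longrightarrow> letter_cycle i ^^ 3 = id"
  by (auto simp: letter_cycle_def numeral_3_eq_3 fun_eq_iff transpose_def)

lemma letter_swap_square: "letter_swap j ^^ 2 = id"
  by (auto simp: letter_swap_def numeral_2_eq_2)

lemma letter_cycle_swap_commute:
  assumes "i \<in> {0, 2, 3, 4}" "j \<in> {0, 2, 3, 4}" "i = j \<longrightarrow> i = 0"
  shows "letter_cycle i \<circ> letter_swap j = letter_swap j \<circ> letter_cycle i"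
  using assms by (auto simp: letter_cycle_def letter_swap_def fun_eq_iff transpose_def)

lemma commute_funpow_comp:
  assumes "f \<circ> g = g \<circ> f"
  shows "(f \<circ> g) ^^ k = f ^^ k \<circ> g ^^ k"
proof (induction k)
  case (Suc k)
  have "(f \<circ> g) ^^ Suc k = f \<circ> (g \<circ> f ^^ k) \<circ> g ^^ k" by (simp only: funpow.simps Suc.IH comp_assoc)
  also have "g \<circ> f ^^ k = f ^^ k \<circ> g"
    using commute_funpow_apply[of g f k] assms by (auto simp: fun_eq_iff)
  finally show ?case by (simp only: funpow.simps comp_assoc)
qed simp

lemma label_perm_pow:
  assumes "l \<in> set labels"
  shows "label_perm l ^^ k = letter_cycle (fst l) ^^ k \<circ> letter_swap (snd l) ^^ k"
  unfolding label_perm_def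
  using commute_funpow_comp[OF letter_cycle_swap_commute] labels_range[OF assms] by blast

text \<open>
  The two commuting factors are recovered as powers, because 3 is 0 modulo 3 and 1 modulo 2, while 4 is 1
  modulo 3 and 0 modulo 2.
\<close>

lemma label_perm_powers_3_4_6:
  assumes "l \<in> set labels"
  shows "label_perm l ^^ 3 = letter_swap (snd l)" "label_perm l ^^ 4 = letter_cycle (fst l)"
    "label_perm l ^^ 6 = id"
proof -
  have c: "letter_cycle (fst l) ^^ 3 = id" using letter_cycle_cube labels_range[OF assms] by blast
  have s: "letter_swap (snd l) ^^ 2 = id" by (rule letter_swap_square)
  have "letter_swap (snd l) ^^ 3 = letter_swap (snd l)" 
    using s by (simp add: numeral_3_eq_3 numeral_2_eq_2)
  then show "label_perm l ^^ 3 = letter_swap (snd l)" by (simp add: label_perm_pow[OF assms] c)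
  have "letter_swap (snd l) ^^ 4 = id" "letter_swap (snd l) ^^ 6 = id"
    using funpow_mult[where f = "letter_swap (snd l)" and m = 2 and n = 2] funpow_mult[where f = "letter_swap (snd l)" and m = 2 and n = 3] s by simp_all
  moreover have "letter_cycle (fst l) ^^ 6 = id" "letter_cycle (fst l) ^^ 4 = letter_cycle (fst l)"
    using funpow_mult[where f = "letter_cycle (fst l)" and m = 3 and n = 2] c funpow_add[where m = 1 and n = 3 and f = "letter_cycle (fst l)"] by simp_all
  ultimately show "label_perm l ^^ 4 = letter_cycle (fst l)" "label_perm l ^^ 6 = id"
    by (simp_all add: label_perm_pow[OF assms])
qed

lemma funpow_fixpoint: "f x = x \<Longrightarrow> (f ^^ m) x = x"
  by (induction m) simp_all

text \<open>
  The cycle \<open>(i 5 6)\<close> moves \<open>i\<close>, while \<open>(i' 5 6)\<close> fixes \<open>i\<close> unless \<open>i = i'\<close>, and so do its powers.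
  The corresponding fact for transpositions holds for the same reason.
\<close>

lemma letter_cycle_pow_eq:
  assumes "i \<in> {0, 2, 3, 4}" "i' \<in> {0, 2, 3, 4}" "letter_cycle i = letter_cycle i' ^^ m"
  shows "i = 0 \<or> i = i'"
proof (rule ccontr)
  assume *: "\<not> (i = 0 \<or> i = i')"
  then have "letter_cycle i' i = i" using assms(1,2) by (auto simp: letter_cycle_def transpose_def)
  then have "letter_cycle i i = i" using assms(3) funpow_fixpoint by metis
  then show False using * assms(1) by (auto simp: letter_cycle_def transpose_def)
qed

lemma letter_swap_pow_eq:
  assumes "j \<in> {0, 2, 3, 4}" "j' \<in> {0, 2, 3, 4}" "letter_swap j = letter_swap j' ^^ m"
  shows "j = 0 \<or> j = j'"
proof (rule ccontr)
  assume *: "\<not> (j = 0 \<or> j = j')"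
  then have "letter_swap j' j = j" using assms(1,2) by (auto simp: letter_swap_def transpose_def)
  then have "letter_swap j j = j" using assms(3) funpow_fixpoint by metis
  then show False using * assms(1) by (auto simp: letter_swap_def transpose_def)
qed

text \<open>
  Taking third and fourth powers splits an equation between a label permutation and a power of another
  one into an equation for the transpositions and one for the 3-cycles.
\<close>

lemma label_le_iff_pow:
  assumes "l \<in> set labels" "l' \<in> set labels"
  shows "label_le l l' \<longleftrightarrow> (\<exists>m>0. label_perm l = label_perm l' ^^ m)"
proof
  assume le: "label_le l l'"
  note P = label_perm_powers_3_4_6[OF assms(2)]
  consider "l = l'" | "fst l = fst l'" "snd l = 0" | "fst l = 0" "snd l = snd l'" | "fst l = 0" "snd l = 0"
    using le unfolding label_le_def by (auto simp: prod_eq_iff)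
  then show "\<exists>m>0. label_perm l = label_perm l' ^^ m"
  proof cases
    case 1
    then show ?thesis by (intro exI[of _ 1]) simp
  next
    case 2
    then have "label_perm l = letter_cycle (fst l')" by (simp add: label_perm_def letter_swap_def)
    then show ?thesis using P(2) by (intro exI[of _ 4]) simp
  next
    case 3
    then have "label_perm l = letter_swap (snd l')" by (simp add: label_perm_def letter_cycle_def)
    then show ?thesis using P(1) by (intro exI[of _ 3]) simp
  next
    case 4
    then have "label_perm l = id" by (simp add: label_perm_def letter_cycle_def letter_swap_def)
    then show ?thesis using P(3) by (intro exI[of _ 6]) simp
  qed
next
  assume "\<exists>m>0. label_perm l = label_perm l' ^^ m"
  then obtain m where m: "label_perm l = label_perm l' ^^ m" by blast
  have pow: "label_perm l ^^ k = (label_perm l' ^^ k) ^^ m" for k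
    unfolding m by (simp add: funpow_mult mult.commute)
  have "letter_cycle (fst l) = letter_cycle (fst l') ^^ m" "letter_swap (snd l) = letter_swap (snd l') ^^ m"
    using pow[of 4] pow[of 3] by (simp_all add: label_perm_powers_3_4_6[OF assms(1)] label_perm_powers_3_4_6[OF assms(2)])
  then show "label_le l l'"
    using letter_cycle_pow_eq[of "fst l" "fst l'" m] letter_swap_pow_eq[of "snd l" "snd l'" m]
      labels_range[OF assms(1)] labels_range[OF assms(2)] by (simp add: label_le_def)
qed

lemma inj_on_label_perm: "inj_on label_perm (set labels)"
proof (rule inj_onI)
  fix l l'
  assume l: "l \<in> set labels" "l' \<in> set labels" and eq: "label_perm l = label_perm l'"
  then have "label_perm l = label_perm l' ^^ 1" "label_perm l' = label_perm l ^^ 1" by simp_all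
  then have "label_le l l'" "label_le l' l" using label_le_iff_pow l by (metis zero_less_one)+
  then show "l = l'" by (auto simp: label_le_def prod_eq_iff)
qed

lemma label_perm_permutes:
  assumes "6 \<le> n" "l \<in> set labels"
  shows "label_perm l permutes {1..n}"
proof -
  have t: "transpose x y permutes {1..n}" if "x \<in> {1, 2, 3, 4, 5, 6}" "y \<in> {1, 2, 3, 4, 5, 6}" for x y
    using that assms(1) by (intro permutes_swap_id) auto
  have "letter_cycle (fst l) permutes {1..n}"
  proof (cases "fst l = 0")
    case False
    then show ?thesis
      using labels_range[OF assms(2)] permutes_compose[OF t t, of 5 6 "fst l" 5]
      by (auto simp: letter_cycle_def)
  qed (simp add: letter_cycle_def permutes_id)
  moreover have "letter_swap (snd l) permutes {1..n}"
  proof (cases "snd l = 0")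
    case False
    then show ?thesis using labels_range[OF assms(2)] t[of 1 "snd l"] by (auto simp: letter_swap_def)
  qed (simp add: letter_swap_def permutes_id)
  ultimately show ?thesis unfolding label_perm_def by (intro permutes_compose)
qed

lemma not_chordal_power_graph_sym_group:
  assumes "6 \<le> n"
  shows "\<not> chordal (power_graph (sym_group n))"
proof -
  let ?G = "power_graph (sym_group n)"
  let ?xs = "map label_perm labels"
  let ?E = "zip labels (rotate1 labels)"
  have zip: "zip ?xs (rotate1 ?xs) = map (map_prod label_perm label_perm) ?E"
    by (simp add: rotate1_map zip_map_map map_prod_def)
  have E_sub: "(set ?E)\<^sup>s \<subseteq> set labels \<times> set labels"
    by (auto simp: symcl_def dest: set_zip_leftD set_zip_rightD)
  have carr: "label_perm l \<in> carrier (sym_group n)" if "l \<in> set labels" for l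
    using label_perm_permutes[OF assms that] by (simp add: sym_group_carrier)
  have "induced_cycle ?G (zip ?xs (rotate1 ?xs))"
  proof (rule induced_cycle_zip_rotate1)
    show "?xs \<noteq> []" by (simp add: labels_def)
    show "distinct ?xs"
      using inj_on_label_perm by (simp add: distinct_map) (simp add: labels_def)
    show "set ?xs \<subseteq> pverts ?G" using carr by (auto simp: power_graph_def)
    fix a b
    assume "a \<in> set ?xs" "b \<in> set ?xs"
    then obtain l l' where l: "l \<in> set labels" "l' \<in> set labels" and ab: "a = label_perm l" "b = label_perm l'"
      by auto
    have "(a, b) \<in> parcs ?G \<longleftrightarrow> l \<noteq> l' \<and> (label_le l l' \<or> label_le l' l)"
      unfolding ab arcs_power_graph power_of_def sym_group_nat_pow
      using carr l label_le_iff_pow inj_on_eq_iff[OF inj_on_label_perm] by simp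
    also have "\<dots> \<longleftrightarrow> (l, l') \<in> (set ?E)\<^sup>s" by (rule labels_adjacent_iff[OF l])
    also have "\<dots> \<longleftrightarrow> (a, b) \<in> map_prod label_perm label_perm ` ((set ?E)\<^sup>s)"
    proof
      assume "(a, b) \<in> map_prod label_perm label_perm ` ((set ?E)\<^sup>s)"
      then obtain k k' where "(k, k') \<in> (set ?E)\<^sup>s" "a = label_perm k" "b = label_perm k'" by auto
      moreover from this have "k = l" "k' = l'"
        using ab l E_sub by (auto intro: inj_onD[OF inj_on_label_perm])
      ultimately show "(l, l') \<in> (set ?E)\<^sup>s" by simp
    qed (auto simp: ab)
    also have "map_prod label_perm label_perm ` ((set ?E)\<^sup>s) = (set (zip ?xs (rotate1 ?xs)))\<^sup>s"
      unfolding zip symcl_def by (force simp: image_iff)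
    finally show "(a, b) \<in> parcs ?G \<longleftrightarrow> (a, b) \<in> (set (zip ?xs (rotate1 ?xs)))\<^sup>s" .
  qed
  moreover have "4 \<le> length (zip ?xs (rotate1 ?xs))" by (simp add: labels_def)
  ultimately show ?thesis unfolding chordal_def by blast
qed

theorem theorem4p2:
  fixes n :: nat
  assumes "n > 0"
  shows "chordal (power_graph (sym_group n)) \<longleftrightarrow> n \<le> 5"
  using chordal_power_graph_sym_group[of n] not_chordal_power_graph_sym_group[of n] by linarith

end
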